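(* Let $a,i,k,l$ be nonnegative integers with $k<l<2^i$, and let $b=2^i+k$ and $c=2^i+l$. Then: (1) if $a\ge 2^i-l$, then $\mathcal{N}(a,b,c)=a+b+c$; (2) if $2^i-k-l\le a<2^i-l$ and $l\le 2^{i-1}$, then $\mathcal{N}(a,b,c)=2a+c+k+l$; (3) if $l>2^{i-1}$ and $\mathcal{N}(a,k,l)\ge 2^i$, then $\mathcal{N}(a,b,c)\ge \mathcal{N}(a,k,l)$; (4) if $\mathcal{N}(a,k,l)<2^i$, then $\mathcal{N}(a,b,c)=\mathcal{N}(a,k,l)$.
   Context: For nonnegative integers $a,b,c$, the position $(a,b,c)$, i.e. the selective compound of the Nim heap $*a$ with the disjunctive sum of the Nim heaps $*b$ and $*c$, is the impartial game (normal play) in which a move consists of one of the following: strictly decrease $a$ only; strictly decrease exactly one of $b,c$ only; or do both simultaneously (strictly decrease $a$ and strictly decrease exactly one of $b,c$). All heap sizes stay nonnegative integers. $\mathcal{N}(a,b,c)$ denotes the Sprague-Grundy value: $0$ at terminal positions, and otherwise the minimum nonnegative integer not occurring among the Sprague-Grundy values of the positions reachable in one move. *)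

theory Defs
  imports Main
begin

definition mex :: "nat set \<Rightarrow> nat" where
  "mex S = (LEAST n. n \<notin> S)"

type_synonym position = "nat \<times> nat \<times> nat"

inductive sum_move :: "nat \<times> nat \<Rightarrow> nat \<times> nat \<Rightarrow> bool" where
  "b' < b \<Longrightarrow> sum_move (b, c) (b', c)"
| "c' < c \<Longrightarrow> sum_move (b, c) (b, c')"

inductive move :: "position \<Rightarrow> position \<Rightarrow> bool" where
  "a' < a \<Longrightarrow> move (a, b, c) (a', b, c)"
| "sum_move (b, c) (b', c') \<Longrightarrow> move (a, b, c) (a, b', c')"
| "a' < a \<Longrightarrow> sum_move (b, c) (b', c') \<Longrightarrow> move (a, b, c) (a', b', c')"

lemma sum_move_decreases: "sum_move p q \<Longrightarrow> fst q + snd q < fst p + snd p"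
  by (induction rule: sum_move.induct) auto

lemma move_decreases:
  "move p q \<Longrightarrow> fst q + fst (snd q) + snd (snd q) < fst p + fst (snd p) + snd (snd p)"
  by (induction rule: move.induct) (auto dest: sum_move_decreases)

text \<open>Terminal positions get value \<open>mex {} = 0\<close>.\<close>

function grundy :: "position \<Rightarrow> nat" where
  "grundy p = mex (grundy ` {q. move p q})"
  by auto
termination
  by (relation "Wellfounded.measure (\<lambda>p. fst p + fst (snd p) + snd (snd p))")
    (auto dest: move_decreases)

declare grundy.simps [simp del]

end

theory Submission
  imports Defs
begin

text \<open>
Three facts govern the whole analysis. A value never exceeds the total number of tokens; it
increases strictly with the heap \<open>a\<close> (\<open>strict_mono_grundy\<close>); and for \<open>a = 0\<close> the game is Nim, so the
value is \<open>b XOR c\<close> (\<open>grundy_0\<close>). Since a player may always throw away all of \<open>a\<close> while moving in one of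
the other heaps, every value that Nim reaches by a move from \<open>(b, c)\<close> is excluded for \<open>(a, b, c)\<close>.
Hence \<open>b \<le> grundy (a, b, c) XOR c\<close>, and if the values of \<open>(0, b, c), \<dots>, (a, b, c)\<close> all lie in one
dyadic block, then these \<open>a + 1\<close> distinct values give \<open>a + 1\<close> distinct numbers that are at least \<open>b\<close>
and lie in one dyadic block as well (\<open>grundy_pigeonhole\<close>). When \<open>a\<close> is too large for that, the value
has to leave the block.

This lower bound improves itself to equality with the number of tokens: once all positions of a
suitable region have a value of at least the smallest token count in the region, any missing value would
be the token count of an option inside the region (\<open>grundy_eq_sum_of_lower_bound\<close>). So \<open>(a, b, c)\<close>
has value \<open>a + b + c\<close> whenever \<open>b < 2 ^ n \<le> a + b\<close> (\<open>grundy_eq_sum\<close>). Applied to the heap \<open>c\<close>, this is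
claim (1).

For \<open>b = 2 ^ i + k\<close> and \<open>c = 2 ^ i + l\<close>, a move that takes just one of the two heaps below \<open>2 ^ i\<close> leads to
a value of at least \<open>2 ^ i\<close>, because all smaller values can still be reached by Nim moves. Below
\<open>2 ^ i\<close>, therefore, \<open>(a, b, c)\<close> and \<open>(a, k, l)\<close> have the same values among their options
(\<open>grundy_shift_eq_iff\<close>), which is claim (4). The values from \<open>2 ^ i\<close> to \<open>2 * 2 ^ i - 1\<close> are all reached
by Nim moves, so \<open>grundy (a, b, c) \<ge> 2 * 2 ^ i\<close> as soon as \<open>grundy (a, k, l) \<ge> 2 ^ i\<close>. As
\<open>grundy (a, k, l) \<le> a + k + l\<close>, this settles claim (3) when \<open>a + l < 2 ^ i\<close>, and claim (1) settles it
otherwise. Claim (2) is an induction (\<open>grundy_shift_intermediate\<close>): options inside the block have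
smaller values of the same form or values below \<open>2 ^ i\<close>, options outside it have too few tokens, and the positions whose
value is their number of tokens fill the range between \<open>2 * 2 ^ i\<close> and the values given by the
induction hypothesis.
\<close>

unbundle bit_operations_syntax

section \<open>Grundy values in general\<close>

lemma move_iff:
  "move (a, b, c) (a', b', c') \<longleftrightarrow>
     a' < a \<and> b' = b \<and> c' = c \<or> a' \<le> a \<and> b' < b \<and> c' = c \<or> a' \<le> a \<and> b' = b \<and> c' < c"
  by (auto simp: move.simps sum_move.simps le_less)

definition option_values :: "position \<Rightarrow> nat set" where
  "option_values p = grundy ` {q. move p q}"

lemma option_valuesI: "move p q \<Longrightarrow> grundy q \<in> option_values p"
  by (auto simp: option_values_def)

lemma option_valuesE:
  assumes "v \<in> option_values (a, b, c)"
  obtains a' b' c' where "move (a, b, c) (a', b', c')" "grundy (a', b', c') = v"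
  using assms by (auto simp: option_values_def)

lemma grundy_eq_mex: "grundy p = mex (option_values p)"
  unfolding option_values_def by (rule grundy.simps)

lemma grundy_le_sum: "grundy (a, b, c) \<le> a + b + c"
proof (induction "a + b + c" arbitrary: a b c rule: less_induct)
  case less
  have "a + b + c \<notin> option_values (a, b, c)"
  proof
    assume "a + b + c \<in> option_values (a, b, c)"
    then obtain a' b' c' where m: "move (a, b, c) (a', b', c')"
      and g: "grundy (a', b', c') = a + b + c"
      by (rule option_valuesE)
    have lt: "a' + b' + c' < a + b + c"
      using m by (auto simp: move_iff)
    show False
      using less[OF lt] g lt by simp
  qed
  then show ?case
    by (simp add: grundy_eq_mex mex_def Least_le)
qed

lemma grundy_notin: "grundy p \<notin> option_values p"
proof -
  obtain a b c where p: "p = (a, b, c)" by (cases p)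
  have "\<exists>n. n \<notin> option_values p"
  proof (rule exI, rule notI)
    assume "Suc (a + b + c) \<in> option_values p"
    then obtain a' b' c' where m: "move (a, b, c) (a', b', c')"
      and g: "grundy (a', b', c') = Suc (a + b + c)"
      unfolding p by (rule option_valuesE)
    show False
      using m g grundy_le_sum[of a' b' c'] by (auto simp: move_iff)
  qed
  then show ?thesis
    unfolding grundy_eq_mex mex_def by (rule LeastI_ex)
qed

lemma less_grundyD: "v < grundy p \<Longrightarrow> v \<in> option_values p"
  unfolding grundy_eq_mex mex_def using not_less_Least by blast

lemma le_grundyI: "{..<v} \<subseteq> option_values p \<Longrightarrow> v \<le> grundy p"
  using grundy_notin[of p] by (meson lessThan_iff not_le subsetD)

lemma grundy_eq_iff:
  "grundy p = v \<longleftrightarrow> v \<notin> option_values p \<and> {..<v} \<subseteq> option_values p"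
  (is "_ \<longleftrightarrow> ?R")
proof
  show ?R if "grundy p = v"
    using that grundy_notin[of p] less_grundyD[of _ p] by blast
  show "grundy p = v" if ?R
    using that grundy_notin less_grundyD le_grundyI by (metis le_neq_implies_less)
qed

text \<open>The two heaps of the disjunctive sum are interchangeable; this transfers every one-sided result to
the other heap.\<close>

lemma grundy_swap: "grundy (a, c, b) = grundy (a, b, c)"
proof (induction "a + b + c" arbitrary: a b c rule: less_induct)
  case less
  have sub: "option_values (a, c, b) \<subseteq> option_values (a, b, c)"
    if IH: "\<And>a' b' c'. a' + b' + c' < a + b + c \<Longrightarrow> grundy (a', c', b') = grundy (a', b', c')"
    for b c
  proof
    fix v
    assume "v \<in> option_values (a, c, b)"
    then obtain a' b' c' where m: "move (a, c, b) (a', c', b')" and g: "grundy (a', c', b') = v"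
      by (rule option_valuesE)
    have "a' + b' + c' < a + b + c" and "move (a, b, c) (a', b', c')"
      using m by (auto simp: move_iff)
    then show "v \<in> option_values (a, b, c)"
      using IH g option_valuesI by metis
  qed
  have "option_values (a, c, b) \<subseteq> option_values (a, b, c)"
    by (rule sub) (rule less)
  moreover have "option_values (a, b, c) \<subseteq> option_values (a, c, b)"
    by (rule sub) (simp add: less[symmetric])
  ultimately have "option_values (a, c, b) = option_values (a, b, c)"
    by (rule subset_antisym)
  then show ?case
    by (simp add: grundy_eq_mex)
qed

text \<open>Every option of \<open>(a', b, c)\<close> remains available after raising \<open>a'\<close> to \<open>a\<close>, and \<open>(a', b, c)\<close> itself becomes
an option.\<close>

lemma strict_mono_grundy: "strict_mono (\<lambda>a. grundy (a, b, c))"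
proof (rule strict_monoI)
  fix a' a :: nat
  assume "a' < a"
  have "option_values (a', b, c) \<subseteq> option_values (a, b, c)"
    using \<open>a' < a\<close> by (force simp: option_values_def move_iff)
  moreover have "grundy (a', b, c) \<in> option_values (a, b, c)"
    using \<open>a' < a\<close> by (intro option_valuesI) (simp add: move_iff)
  ultimately have "{..<Suc (grundy (a', b, c))} \<subseteq> option_values (a, b, c)"
    using less_grundyD by (force simp: less_Suc_eq)
  then show "grundy (a', b, c) < grundy (a, b, c)"
    using le_grundyI[of "Suc (grundy (a', b, c))" "(a, b, c)"] by simp
qed

lemma grundy_mono: "a' \<le> a \<Longrightarrow> grundy (a', b, c) \<le> grundy (a, b, c)"
  by (rule strict_mono_less_eq[OF strict_mono_grundy, THEN iffD2])

section \<open>Nim addition\<close>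

lemma xor_cancel: "(x XOR y) XOR y = x" "(x XOR y) XOR x = y" for x y :: nat
proof -
  show *: "(x XOR y) XOR y = x" for x y :: nat
    by (simp add: xor.assoc)
  show "(x XOR y) XOR x = y"
    using *[of y x] by (simp only: xor.commute)
qed

lemma less_iff_div_mod_2:
  fixes x y :: nat
  shows "x < y \<longleftrightarrow> x div 2 < y div 2 \<or> x div 2 = y div 2 \<and> even x \<and> odd y"
  by (cases "even x"; cases "even y") (auto elim!: evenE oddE)

lemma xor_div_power: "(x XOR y) div 2 ^ n = (x div 2 ^ n) XOR (y div 2 ^ n)" for x y :: nat
  using drop_bit_xor[of n x y] by (simp add: drop_bit_eq_div)

lemma xor_div_2: "(x XOR y) div 2 = (x div 2) XOR (y div 2)" for x y :: nat
  using xor_div_power[of x y 1] by simp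

text \<open>The winning move of Nim with heaps \<open>v\<close>, \<open>k\<close>, \<open>l\<close>: if \<open>v\<close> is already smaller than the value that would
balance the position, then one of the two other heaps can be reduced to balance it. The induction
strips the lowest bit.\<close>

lemma less_xorD:
  fixes v k l :: nat
  assumes "v < k XOR l"
  shows "v XOR l < k \<or> v XOR k < l"
  using assms
proof (induction v arbitrary: k l rule: less_induct)
  case (less v)
  have "v div 2 < (k XOR l) div 2
      \<or> v div 2 = (k XOR l) div 2 \<and> even v \<and> odd (k XOR l)"
    using less.prems less_iff_div_mod_2 by blast
  then show ?case
  proof
    assume lt: "v div 2 < (k XOR l) div 2"
    show ?thesis
    proof (cases "v = 0")
      case True
      then have "k \<noteq> l"
        using less.prems by auto
      then show ?thesis
        using True by auto
    next
      case False
      then have "v div 2 < v"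
        by simp
      moreover have "v div 2 < (k div 2) XOR (l div 2)"
        using lt by (simp only: xor_div_2)
      ultimately have "(v XOR l) div 2 < k div 2 \<or> (v XOR k) div 2 < l div 2"
        unfolding xor_div_2 by (rule less.IH)
      then show ?thesis
        using less_iff_div_mod_2 by blast
    qed
  next
    assume eq: "v div 2 = (k XOR l) div 2 \<and> even v \<and> odd (k XOR l)"
    then have "(v XOR l) div 2 = k div 2" and "(v XOR k) div 2 = l div 2"
      by (simp_all only: xor_div_2 xor_cancel)
    moreover have "odd k \<and> even (v XOR l) \<or> odd l \<and> even (v XOR k)"
      using eq unfolding even_xor_iff by blast
    ultimately show ?thesis
      using less_iff_div_mod_2 by blast
  qed
qed

lemma grundy_0: "grundy (0, b, c) = b XOR c"
proof (induction "b + c" arbitrary: b c rule: less_induct)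
  case less
  have "b XOR c \<notin> option_values (0, b, c)"
  proof
    assume "b XOR c \<in> option_values (0, b, c)"
    then obtain a' b' c' where m: "move (0, b, c) (a', b', c')"
      and g: "grundy (a', b', c') = b XOR c"
      by (rule option_valuesE)
    have "b' XOR c' = b XOR c"
      using m g less[of b' c'] by (auto simp: move_iff)
    moreover have "b' = b \<and> c' < c \<or> b' < b \<and> c' = c"
      using m by (auto simp: move_iff)
    ultimately show False
      using xor_cancel[of b' c'] xor_cancel[of b c] by auto
  qed
  moreover have "v \<in> option_values (0, b, c)" if v: "v < b XOR c" for v
    using less_xorD[OF v]
  proof
    assume lt: "v XOR c < b"
    have "grundy (0, v XOR c, c) = v"
      using less[of "v XOR c" c] lt by (simp add: xor_cancel)
    then show ?thesis
      using option_valuesI[of "(0, b, c)" "(0, v XOR c, c)"] lt by (simp add: move_iff)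
  next
    assume lt: "v XOR b < c"
    have "grundy (0, b, v XOR b) = v"
      using less[of b "v XOR b"] lt by (simp add: xor.commute[of b] xor_cancel)
    then show ?thesis
      using option_valuesI[of "(0, b, c)" "(0, b, v XOR b)"] lt by (simp add: move_iff)
  qed
  ultimately show ?case
    by (auto simp: grundy_eq_iff)
qed

text \<open>A move may discard all of \<open>a\<close> and at the same time play in the sum, so each value reachable from
\<open>(b, c)\<close> in Nim is reachable from \<open>(a, b, c)\<close>. Consequently such a value is never that of \<open>(a, b, c)\<close>.\<close>

lemma nim_option_left: "v XOR c < b \<Longrightarrow> v \<in> option_values (a, b, c)"
  using option_valuesI[of "(a, b, c)" "(0, v XOR c, c)"] by (simp add: move_iff grundy_0 xor_cancel)

lemma nim_option_right: "v XOR b < c \<Longrightarrow> v \<in> option_values (a, b, c)"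
  using option_valuesI[of "(a, b, c)" "(0, b, v XOR b)"]
  by (simp add: move_iff grundy_0 xor.commute[of b] xor_cancel)

lemma le_grundy_xor_right: "b \<le> grundy (a, b, c) XOR c"
  using nim_option_left grundy_notin not_le by blast

lemma le_grundy_xor_left: "c \<le> grundy (a, b, c) XOR b"
  using nim_option_right grundy_notin not_le by blast

text \<open>Numbers in the same dyadic block of length \<open>2 ^ n\<close> share all bits from position \<open>n\<close> on.\<close>

lemma xor_less_power:
  fixes x y :: nat
  assumes "x div 2 ^ n = y div 2 ^ n"
  shows "x XOR y < 2 ^ n"
  using xor_div_power[of x y n] assms by (simp add: div_eq_0_iff)

text \<open>Reducing \<open>c\<close> to any heap below \<open>2 ^ n\<close> while discarding \<open>a\<close> reaches all the values \<open>b XOR c'\<close> with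
\<open>c' < 2 ^ n\<close>, and these are all the numbers below \<open>2 ^ n\<close>.\<close>

lemma power_le_grundy_of_separated:
  assumes "b < 2 ^ n" and "2 ^ n \<le> c"
  shows "2 ^ n \<le> grundy (a, b, c)"
proof (intro le_grundyI subsetI nim_option_right)
  fix v :: nat
  assume "v \<in> {..<2 ^ n}"
  then have "v XOR b < 2 ^ n"
    using assms(1) by (intro xor_less_power) simp
  then show "v XOR b < c"
    using assms(2) by simp
qed

section \<open>Positions of largest possible value\<close>

text \<open>The \<open>a + 1\<close> values for the heaps \<open>0, \<dots>, a\<close> are distinct by strict monotonicity, and by
\<open>le_grundy_xor_right\<close> their translates under \<open>XOR c\<close> all lie in \<open>{b..<M}\<close>. This forces the values of the
later lemmas out of a dyadic block: if they stayed in it, \<open>M\<close> could be chosen too small.\<close>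

lemma grundy_pigeonhole:
  assumes "\<And>a'. a' \<le> a \<Longrightarrow> grundy (a', b, c) XOR c < M"
  shows "a + b < M"
proof -
  let ?f = "\<lambda>a'. grundy (a', b, c) XOR c"
  have "inj_on ?f {..a}"
  proof (rule inj_onI)
    fix x y
    assume "?f x = ?f y"
    then have "grundy (x, b, c) = grundy (y, b, c)"
      by (metis xor_cancel(1))
    then show "x = y"
      using strict_mono_grundy strict_mono_eq by blast
  qed
  moreover have "?f ` {..a} \<subseteq> {b..<M}"
    using assms le_grundy_xor_right by auto
  ultimately have "card {..a} \<le> card {b..<M}"
    by (intro card_inj_on_le) auto
  then show ?thesis by simp
qed

lemma sum_of_bounded_summands:
  fixes s :: nat
  assumes "\<alpha> \<le> a" and "\<gamma> \<le> c" and "\<alpha> + \<gamma> \<le> s" and "s \<le> a + c"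
  obtains a' c' where "\<alpha> \<le> a'" "a' \<le> a" "\<gamma> \<le> c'" "c' \<le> c" "a' + c' = s"
proof (cases "s \<le> a + \<gamma>")
  case True
  show ?thesis
    by (rule that[of "s - \<gamma>" \<gamma>]) (use assms True in linarith)+
next
  case False
  show ?thesis
    by (rule that[of a "s - a"]) (use assms False in linarith)+
qed

text \<open>On the rectangle \<open>a' \<ge> \<alpha>\<close>, \<open>\<gamma> \<le> c' \<le> c\<close>, it suffices that no value falls below the token count
\<open>\<alpha> + b + \<gamma>\<close> of the smallest corner. Were the value at \<open>(a, b, c)\<close> less than \<open>a + b + c\<close>, it would
be the token count of some smaller position of the rectangle; by induction it would then be the value
of that position, which is an option.\<close>

lemma grundy_eq_sum_of_lower_bound:
  assumes low: "\<And>a' c'. \<alpha> \<le> a' \<Longrightarrow> \<gamma> \<le> c' \<Longrightarrow> c' \<le> c \<Longrightarrow> \<alpha> + b + \<gamma> \<le> grundy (a', b, c')"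
    and "\<alpha> \<le> a" and "\<gamma> \<le> c"
  shows "grundy (a, b, c) = a + b + c"
  using assms
proof (induction "a + c" arbitrary: a c rule: less_induct)
  case less
  show ?case
  proof (rule ccontr)
    assume "grundy (a, b, c) \<noteq> a + b + c"
    then have lt: "grundy (a, b, c) < a + b + c"
      using grundy_le_sum[of a b c] by simp
    have ge: "\<alpha> + b + \<gamma> \<le> grundy (a, b, c)"
      using less.prems by simp
    have "\<alpha> + \<gamma> \<le> grundy (a, b, c) - b" and "grundy (a, b, c) - b \<le> a + c"
      using lt ge by linarith+
    with less.prems(2,3) obtain a' c'
      where a': "\<alpha> \<le> a'" "a' \<le> a" and c': "\<gamma> \<le> c'" "c' \<le> c"
        and "a' + c' = grundy (a, b, c) - b"
      by (rule sum_of_bounded_summands)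
    then have sum: "a' + b + c' = grundy (a, b, c)"
      using ge by linarith
    have "grundy (a', b, c') = a' + b + c'"
    proof (rule less.hyps)
      show "a' + c' < a + c"
        using sum lt by linarith
      show "\<alpha> + b + \<gamma> \<le> grundy (x, b, y)" if "\<alpha> \<le> x" "\<gamma> \<le> y" "y \<le> c'" for x y
        using less.prems(1) that c'(2) by simp
    qed (fact a' c')+
    moreover have "move (a, b, c) (a', b, c')"
      using a' c' sum lt unfolding move_iff by linarith
    ultimately show False
      using sum option_valuesI grundy_notin by metis
  qed
qed

text \<open>For heaps \<open>c' < 2 ^ n\<close>, values below \<open>2 ^ n\<close> would be translated by \<open>XOR c'\<close> into \<open>{b..<2 ^ n}\<close>, which has
no room for more than \<open>2 ^ n - b\<close> of them; for \<open>c' \<ge> 2 ^ n\<close> the two heaps are separated.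
So values are at least \<open>2 ^ n\<close>, the token count of the corner \<open>(2 ^ n - b, b, 0)\<close>.\<close>

lemma grundy_eq_sum:
  assumes "b < 2 ^ n" and "2 ^ n \<le> a + b"
  shows "grundy (a, b, c) = a + b + c"
proof (rule grundy_eq_sum_of_lower_bound[where \<alpha> = "2 ^ n - b" and \<gamma> = 0])
  fix a' c' :: nat
  assume a': "2 ^ n - b \<le> a'"
  have "2 ^ n \<le> grundy (a', b, c')"
  proof (cases "c' < 2 ^ n")
    case True
    show ?thesis
    proof (rule ccontr)
      assume contr: "\<not> 2 ^ n \<le> grundy (a', b, c')"
      have "grundy (x, b, c') XOR c' < 2 ^ n" if "x \<le> a'" for x
      proof (rule xor_less_power)
        have "grundy (x, b, c') \<le> grundy (a', b, c')"
          using grundy_mono[OF that] .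
        then show "grundy (x, b, c') div 2 ^ n = c' div 2 ^ n"
          using contr True by simp
      qed
      then have "a' + b < 2 ^ n"
        by (rule grundy_pigeonhole)
      then show False
        using a' by simp
    qed
  next
    case False
    then show ?thesis
      using power_le_grundy_of_separated assms(1) by simp
  qed
  then show "2 ^ n - b + b + 0 \<le> grundy (a', b, c')"
    using assms(1) by simp
qed (use assms in auto)

text \<open>Here \<open>a\<close> may be smaller by \<open>2 ^ n\<close> than what \<open>grundy_eq_sum\<close> demands for the heap \<open>2 ^ Suc n + k\<close>,
at the price of confining \<open>c\<close> to the upper half of \<open>{0..<2 ^ Suc n}\<close>. Seen in blocks of length \<open>2 ^ n\<close>,
the two heaps of the sum lie in blocks 2 and 1. A value below \<open>4 * 2 ^ n\<close> has to lie in block 2 or 3, since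
\<open>b\<close> and \<open>c\<close> are separated by \<open>2 ^ Suc n\<close>; block 2 is excluded because Nim moves of \<open>c\<close> reach all of it; and
block 3 is translated by \<open>XOR c\<close> into block 2, where only \<open>2 ^ n - k\<close> numbers are at least
\<open>2 ^ Suc n + k\<close>.\<close>

lemma grundy_eq_sum_shifted:
  assumes "k < 2 ^ n" and "2 ^ n \<le> a + k" and "2 ^ n \<le> c" and "c < 2 ^ Suc n"
  shows "grundy (a, 2 ^ Suc n + k, c) = a + (2 ^ Suc n + k) + c"
proof (rule grundy_eq_sum_of_lower_bound[where \<alpha> = "2 ^ n - k" and \<gamma> = "2 ^ n"])
  fix a' c' :: nat
  let ?b = "2 ^ Suc n + k"
  assume a': "2 ^ n - k \<le> a'" and c': "2 ^ n \<le> c'" "c' \<le> c"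
  have "2 * 2 ^ Suc n \<le> grundy (a', ?b, c')"
  proof (rule ccontr)
    assume contr: "\<not> 2 * 2 ^ Suc n \<le> grundy (a', ?b, c')"
    have "grundy (x, ?b, c') XOR c' < 3 * 2 ^ n" if x: "x \<le> a'" for x
    proof -
      let ?u = "grundy (x, ?b, c')"
      have "?u \<le> grundy (a', ?b, c')"
        using grundy_mono[OF x] .
      then have hi: "?u < 4 * 2 ^ n"
        using contr by simp
      have lo: "2 * 2 ^ n \<le> ?u"
        using power_le_grundy_of_separated[of c' "Suc n" ?b x] c' assms(4) grundy_swap by simp
      have b: "?b div 2 ^ n = 2" and c: "c' div 2 ^ n = 1"
        using assms c' by (auto intro!: div_nat_eqI)
      have "?u div 2 ^ n \<noteq> 2"
        using le_grundy_xor_left[of c' x ?b] xor_less_power[of ?u n ?b] b c' by linarith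
      moreover have "2 \<le> ?u div 2 ^ n" "?u div 2 ^ n < 4"
        using hi lo by (auto simp: less_eq_div_iff_mult_less_eq div_less_iff_less_mult)
      ultimately have "?u div 2 ^ n = 3"
        by linarith
      then have "(?u XOR c') div 2 ^ n < 3"
        by (simp add: xor_div_power c)
      then show ?thesis
        by (simp add: div_less_iff_less_mult)
    qed
    then have "a' + ?b < 3 * 2 ^ n"
      by (rule grundy_pigeonhole)
    then show False
      using a' by simp
  qed
  then show "2 ^ n - k + ?b + 2 ^ n \<le> grundy (a', ?b, c')"
    using assms(1) by simp
qed (use assms in auto)

section \<open>Adding the same power of two to both summands\<close>

text \<open>An option of the shifted position with a value below \<open>2 ^ i\<close> has both heaps still at least \<open>2 ^ i\<close>, by
\<open>power_le_grundy_of_separated\<close>. So it is itself the shift of an option of \<open>(a, k, l)\<close>, and the induction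
hypothesis matches their values.\<close>

lemma grundy_shift_eq_iff:
  assumes "k < 2 ^ i" and "l < 2 ^ i" and "v < 2 ^ i"
  shows "grundy (a, 2 ^ i + k, 2 ^ i + l) = v \<longleftrightarrow> grundy (a, k, l) = v"
  using assms
proof (induction "a + k + l" arbitrary: a k l v rule: less_induct)
  case less
  let ?p = "2 ^ i :: nat"
  have IH: "grundy (a', ?p + k', ?p + l') = u \<longleftrightarrow> grundy (a', k', l') = u"
    if "move (a, k, l) (a', k', l')" "u < ?p" for a' k' l' u
    using that less.prems(1,2) by (intro less.hyps) (auto simp: move_iff)
  have "u \<in> option_values (a, ?p + k, ?p + l) \<longleftrightarrow> u \<in> option_values (a, k, l)" if u: "u < ?p" for u
  proof
    assume "u \<in> option_values (a, k, l)"
    then obtain a' k' l' where m: "move (a, k, l) (a', k', l')" and g: "grundy (a', k', l') = u"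
      by (rule option_valuesE)
    have "move (a, ?p + k, ?p + l) (a', ?p + k', ?p + l')"
      using m by (simp add: move_iff)
    then show "u \<in> option_values (a, ?p + k, ?p + l)"
      using IH[OF m u] g option_valuesI by metis
  next
    assume "u \<in> option_values (a, ?p + k, ?p + l)"
    then obtain a' b' c' where m: "move (a, ?p + k, ?p + l) (a', b', c')"
      and g: "grundy (a', b', c') = u"
      by (rule option_valuesE)
    have "\<not> (b' < ?p \<and> ?p \<le> c')" "\<not> (c' < ?p \<and> ?p \<le> b')"
      using power_le_grundy_of_separated[of b' i c' a'] power_le_grundy_of_separated[of c' i b' a']
        g u grundy_swap by auto
    then obtain k' l' where "b' = ?p + k'" "c' = ?p + l'"
      using m unfolding move_iff by (metis le_add1 le_Suc_ex linorder_not_less)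
    then have "move (a, k, l) (a', k', l')" and "grundy (a', k', l') = u"
      using m g IH[of a' k' l' u] u by (auto simp: move_iff)
    then show "u \<in> option_values (a, k, l)"
      using option_valuesI by metis
  qed
  then show ?case
    using less.prems(3) by (auto simp: grundy_eq_iff subset_eq)
qed

text \<open>Reducing the first heap below \<open>2 ^ i\<close> by a Nim move gives every value in the block of the second
heap.\<close>

lemma option_values_same_block:
  assumes "l < 2 ^ i" and "2 ^ i \<le> v" and "v < 2 * 2 ^ i"
  shows "v \<in> option_values (a, 2 ^ i + k, 2 ^ i + l)"
proof (rule nim_option_left)
  have "v div 2 ^ i = 1" and "(2 ^ i + l) div 2 ^ i = 1"
    using assms by (auto intro!: div_nat_eqI)
  then have "v XOR (2 ^ i + l) < 2 ^ i"
    by (intro xor_less_power) simp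
  then show "v XOR (2 ^ i + l) < 2 ^ i + k" by simp
qed

lemma grundy_shift_ge:
  assumes "k < 2 ^ i" and "l < 2 ^ i" and "2 ^ i \<le> grundy (a, k, l)"
  shows "2 * 2 ^ i \<le> grundy (a, 2 ^ i + k, 2 ^ i + l)"
proof (rule le_grundyI, rule subsetI)
  fix v :: nat
  assume v: "v \<in> {..<2 * 2 ^ i}"
  have "2 ^ i \<le> grundy (a, 2 ^ i + k, 2 ^ i + l)"
    using grundy_shift_eq_iff[OF assms(1,2)] assms(3) by (metis linorder_not_less)
  then show "v \<in> option_values (a, 2 ^ i + k, 2 ^ i + l)"
    using v less_grundyD option_values_same_block assms(2)
    by (cases "v < 2 ^ i") auto
qed

text \<open>The case \<open>k = l\<close> is included because the induction passes through it when the larger heap is reduced.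
The hypothesis \<open>2 ^ Suc n \<le> a + k + l\<close> marks exactly where the values leave \<open>{..<2 ^ Suc n}\<close>; an option
with fewer tokens takes over the small value of its unshifted counterpart.\<close>

lemma grundy_shift_intermediate:
  assumes "k \<le> l" and "k < 2 ^ n" and "l \<le> 2 ^ n" and "2 ^ Suc n \<le> a + k + l" and "a + l < 2 ^ Suc n"
  shows "grundy (a, 2 ^ Suc n + k, 2 ^ Suc n + l) = 2 ^ Suc n + 2 * a + k + 2 * l"
  using assms
proof (induction "a + k + l" arbitrary: a k l rule: less_induct)
  case less
  let ?p = "2 ^ Suc n :: nat"
  let ?T = "?p + 2 * a + k + 2 * l"
  note prems = less.prems
  have p: "0 < ?p"
    by simp
  have kl: "k < ?p" "l < ?p"
    using prems by auto
  have "grundy (a', b', c') < ?T" if m: "move (a, ?p + k, ?p + l) (a', b', c')" for a' b' c'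
  proof (cases "?p \<le> b' \<and> ?p \<le> c'")
    case False
    \<comment> \<open>One heap has dropped below \<open>?p\<close>; the token count is at most \<open>2 * ?p + a + l - 1\<close>, while \<open>?T\<close> is
      at least \<open>2 * ?p + a + l\<close>.\<close>
    then have "a' + b' + c' < ?T"
      using m prems by (auto simp: move_iff)
    then show ?thesis
      using grundy_le_sum[of a' b' c'] by simp
  next
    case True
    then obtain k' l' where b': "b' = ?p + k'" and c': "c' = ?p + l'"
      using le_Suc_ex by meson
    have m': "a' < a \<and> k' = k \<and> l' = l \<or> a' \<le> a \<and> k' < k \<and> l' = l \<or> a' \<le> a \<and> k' = k \<and> l' < l"
      using m by (auto simp: move_iff b' c')
    show ?thesis
    proof (cases "a' + k' + l' < ?p")
      case True
      then have "grundy (a', b', c') = grundy (a', k', l')"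
        using grundy_shift_eq_iff[of k' "Suc n" l'] grundy_le_sum[of a' k' l'] kl m'
        unfolding b' c' by auto
      then show ?thesis
        using True grundy_le_sum[of a' k' l'] by simp
    next
      case big: False
      show ?thesis
      proof (cases "k' \<le> l'")
        case True
        then have "grundy (a', b', c') = ?p + 2 * a' + k' + 2 * l'"
          unfolding b' c' using big m' prems by (intro less.hyps) auto
        then show ?thesis
          using m' by auto
      next
        case False
        then have "grundy (a', c', b') = ?p + 2 * a' + l' + 2 * k'"
          unfolding b' c' using big m' prems by (intro less.hyps) auto
        then show ?thesis
          using m' False prems(1) grundy_swap[of a' b' c'] by auto
      qed
    qed
  qed
  then have "?T \<notin> option_values (a, ?p + k, ?p + l)"
    by (metis option_valuesE less_irrefl)
  moreover have "v \<in> option_values (a, ?p + k, ?p + l)" if v: "v < ?T" for v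
  proof -
    \<comment> \<open>This inequality leaves no gap between the second and third of the following ranges.\<close>
    have "l \<le> a + k"
      using prems(3,4) by simp
    then consider "v < 2 * ?p" | "2 * ?p \<le> v" "v < 2 * ?p + a + k"
      | "2 * ?p + l \<le> v" "v < 2 * ?p + a + l" | "2 * ?p + a + l \<le> v"
      by linarith
    then show ?thesis
    proof cases
      case 1
      have "grundy (a, k, l) = a + k + l"
        using prems by (intro grundy_eq_sum[of k n]) auto
      then show ?thesis
        using 1 grundy_shift_ge[OF kl, of a] prems(4) by (intro less_grundyD) auto
    next
      case 2
      \<comment> \<open>Reducing the heap \<open>?p + l\<close> to some \<open>c'\<close> in \<open>{2 ^ n..<?p}\<close> gives the token count as value, by
        \<open>grundy_eq_sum_shifted\<close>. The bound \<open>2 ^ n - k \<le> a'\<close> is what that lemma requires.\<close>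
      have "2 ^ n - k \<le> a" "2 ^ n \<le> ?p - 1"
          "2 ^ n - k + 2 ^ n \<le> v - ?p - k" "v - ?p - k \<le> a + (?p - 1)"
        using 2 prems by auto
      then obtain a' c' where a': "2 ^ n - k \<le> a'" "a' \<le> a"
        and c': "2 ^ n \<le> c'" "c' \<le> ?p - 1" and sum: "a' + c' = v - ?p - k"
        by (rule sum_of_bounded_summands)
      have "c' < ?p"
        using c'(2) p by linarith
      then have "grundy (a', ?p + k, c') = a' + (?p + k) + c'"
        using a' c' prems by (intro grundy_eq_sum_shifted) auto
      also have "\<dots> = v"
        using sum 2 prems by linarith
      finally show ?thesis
        using a' \<open>c' < ?p\<close> option_valuesI[of "(a, ?p + k, ?p + l)" "(a', ?p + k, c')"]
        by (simp add: move_iff)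
    next
      case 3
      \<comment> \<open>Reducing the heap \<open>?p + k\<close> to some \<open>b' < ?p\<close> gives the token count as value if \<open>?p \<le> a' + b'\<close>,
        by \<open>grundy_eq_sum\<close>.\<close>
      have "0 \<le> a" "0 \<le> ?p - 1" "0 + 0 \<le> v - ?p - l" "v - ?p - l \<le> a + (?p - 1)"
        using 3 by auto
      then obtain a' b' where a': "a' \<le> a" and b': "b' \<le> ?p - 1"
        and sum: "a' + b' = v - ?p - l"
        by (rule sum_of_bounded_summands)
      have "b' < ?p"
        using b' p by linarith
      moreover have "?p \<le> a' + b'"
        using sum 3 by linarith
      ultimately have "grundy (a', b', ?p + l) = a' + b' + (?p + l)"
        by (rule grundy_eq_sum)
      also have "\<dots> = v"
        using sum 3 by linarith
      finally show ?thesis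
        using a' \<open>b' < ?p\<close> option_valuesI[of "(a, ?p + k, ?p + l)" "(a', b', ?p + l)"]
        by (simp add: move_iff)
    next
      case 4
      \<comment> \<open>By the induction hypothesis, lowering \<open>k\<close> alone lowers the value by the same amount, as long as
        \<open>?p\<close> tokens remain in \<open>(a, k', l)\<close>; this is how far down the range of this case goes.\<close>
      define k' where "k' = k - (?T - v)"
      have *: "k' < k" "?p + 2 * a + k' + 2 * l = v" "?p \<le> a + k' + l"
        using 4 v prems by (auto simp: k'_def)
      then have "grundy (a, ?p + k', ?p + l) = v"
        using less.hyps[of a k' l] prems by simp
      then show ?thesis
        using * option_valuesI[of "(a, ?p + k, ?p + l)" "(a, ?p + k', ?p + l)"]
        by (simp add: move_iff)
    qed
  qed
  ultimately show ?case
    by (auto simp: grundy_eq_iff)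
qed

section \<open>The values for two summands in the same dyadic block\<close>

theorem theorem3:
  fixes a i k l b c :: nat
  assumes "k < l" and "l < 2 ^ i"
    and "b = 2 ^ i + k" and "c = 2 ^ i + l"
  shows "(2 ^ i - l \<le> a \<longrightarrow> grundy (a, b, c) = a + b + c)
    \<and> (2 ^ i \<le> a + k + l \<and> a < 2 ^ i - l \<and> l \<le> 2 ^ (i - 1)
         \<longrightarrow> grundy (a, b, c) = 2 * a + c + k + l)
    \<and> (l > 2 ^ (i - 1) \<and> grundy (a, k, l) \<ge> 2 ^ i
         \<longrightarrow> grundy (a, b, c) \<ge> grundy (a, k, l))
    \<and> (grundy (a, k, l) < 2 ^ i \<longrightarrow> grundy (a, b, c) = grundy (a, k, l))"
proof (intro conjI impI; (elim conjE)?)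
  have kl: "k < 2 ^ i" "l < 2 ^ i"
    using assms by auto
  have full: "grundy (a, b, c) = a + b + c" if "2 ^ i - l \<le> a"
    using grundy_eq_sum[of c "Suc i" a b] that assms grundy_swap[of a b c] by simp
  then show "2 ^ i - l \<le> a \<Longrightarrow> grundy (a, b, c) = a + b + c" .
  show "grundy (a, b, c) = 2 * a + c + k + l"
    if h: "2 ^ i \<le> a + k + l" "a < 2 ^ i - l" "l \<le> 2 ^ (i - 1)"
  proof -
    obtain n where "i = Suc n"
      using assms by (cases i) auto
    then show ?thesis
      using h assms grundy_shift_intermediate[of k l n a] by simp
  qed
  show "grundy (a, k, l) \<le> grundy (a, b, c)" if "2 ^ i \<le> grundy (a, k, l)"
  proof (cases "2 ^ i - l \<le> a")
    case True
    then show ?thesis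
      using full grundy_le_sum[of a k l] assms by simp
  next
    case False
    then have "grundy (a, k, l) \<le> 2 * 2 ^ i"
      using grundy_le_sum[of a k l] assms by simp
    also have "\<dots> \<le> grundy (a, b, c)"
      using grundy_shift_ge[OF kl that] assms by simp
    finally show ?thesis .
  qed
  show "grundy (a, b, c) = grundy (a, k, l)" if "grundy (a, k, l) < 2 ^ i"
    using grundy_shift_eq_iff[OF kl that] assms by simp
qed

end
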